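(* Fix $\gamma\in(0,1]$ and $0<\alpha<\frac14$, and let $\xi>0$ be arbitrarily small. Then for all sufficiently large $N$, $$\mathbb E\big[\|S-s^*\|^2\big]\le\begin{cases}\dfrac{1}{N^{1-2\alpha-4\xi}}, & 0<\alpha<\frac1{12},\\[2mm] \dfrac{1}{N^{1-4\alpha-7\xi}}, & \frac1{12}\le\alpha<\frac14.\end{cases}$$
   Context: Model. Let $N\ge1$ be the number of servers, $\gamma\in(0,1]$ and $\alpha>0$ constants, and $\lambda=1-\gamma/N^{\alpha}$. Let $b=b(N)\ge1$ be an integer buffer size with $b=O(\log N)$. Each of the $N$ servers holds at most $b$ jobs; jobs arrive as a Poisson process of rate $\lambda N$, service times are i.i.d. exponential with rate $1$, and each arriving job samples two servers uniformly at random and joins the one with fewer jobs (ties broken uniformly). Let $S_i(t)$ be the fraction of servers with at least $i$ jobs; $S(t)=(S_1(t),\dots,S_b(t))$ is a continuous-time Markov chain on $\{s\in\{0,\frac1N,\dots,1\}^b:1\ge s_1\ge\cdots\ge s_b\ge0\}$ with, using $s_0=1$, $s_{b+1}=0$ and $e_k$ the $k$-th unit vector, transitions $s\to s+e_k/N$ at rate $\lambda N(s_{k-1}^2-s_k^2)$ and $s\to s-e_k/N$ at rate $N(s_k-s_{k+1})$. $S$ denotes a random vector with the stationary distribution of this chain. $s^*$ is the unique point of $\mathcal S=\{s\in\mathbb R^b:1\ge s_1\ge\cdots\ge s_b\ge0\}$ with $f(s^* )=0$, where $f_k(s)=\lambda(s_{k-1}^2-s_k^2)-(s_k-s_{k+1})$,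 $k=1,\dots,b$ (with $s_0=1,s_{b+1}=0$). $\|\cdot\|$ is the Euclidean norm. *)

theory Defs
  imports "HOL-Probability.Probability" "HOL-Library.Landau_Symbols"
begin

text \<open>States are functions nat => real; only components 1..b are meaningful,
  all other components are 0. Component k is the fraction s_k of servers with
  at least k jobs.\<close>

definition jsq_states :: "nat \<Rightarrow> nat \<Rightarrow> (nat \<Rightarrow> real) set" where
  "jsq_states N b = {s. (\<forall>k. (k = 0 \<or> k > b) \<longrightarrow> s k = 0)
      \<and> (\<forall>k\<in>{1..b}. \<exists>m::nat. m \<le> N \<and> s k = real m / real N)
      \<and> (\<forall>k\<in>{1..<b}. s (Suc k) \<le> s k)}"

definition sext :: "nat \<Rightarrow> (nat \<Rightarrow> real) \<Rightarrow> nat \<Rightarrow> real" where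
  "sext b s k = (if k = 0 then 1 else if k \<le> b then s k else 0)"

definition unitv :: "nat \<Rightarrow> nat \<Rightarrow> real" where
  "unitv k = (\<lambda>j. if j = k then 1 else 0)"

definition jsq_rate :: "nat \<Rightarrow> nat \<Rightarrow> real \<Rightarrow> (nat \<Rightarrow> real) \<Rightarrow> (nat \<Rightarrow> real) \<Rightarrow> real" where
  "jsq_rate N b lam s s' =
     (\<Sum>k\<in>{1..b}.
        (if s' = (\<lambda>j. s j + unitv k j / real N)
         then lam * real N * ((sext b s (k-1))\<^sup>2 - (sext b s k)\<^sup>2) else 0)
      + (if s' = (\<lambda>j. s j - unitv k j / real N)
         then real N * (sext b s k - sext b s (Suc k)) else 0))"

definition jsq_stationary :: "nat \<Rightarrow> nat \<Rightarrow> real \<Rightarrow> (nat \<Rightarrow> real) pmf \<Rightarrow> bool" where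
  "jsq_stationary N b lam p \<longleftrightarrow>
     set_pmf p \<subseteq> jsq_states N b \<and>
     (\<forall>x\<in>jsq_states N b.
        pmf p x * (\<Sum>y\<in>jsq_states N b - {x}. jsq_rate N b lam x y)
        = (\<Sum>y\<in>jsq_states N b - {x}. pmf p y * jsq_rate N b lam y x))"

definition drift :: "nat \<Rightarrow> real \<Rightarrow> (nat \<Rightarrow> real) \<Rightarrow> nat \<Rightarrow> real" where
  "drift b lam s k = lam * ((sext b s (k-1))\<^sup>2 - (sext b s k)\<^sup>2)
                     - (sext b s k - sext b s (Suc k))"

definition simplexS :: "nat \<Rightarrow> (nat \<Rightarrow> real) set" where
  "simplexS b = {s. (\<forall>k\<in>{1..b}. 0 \<le> s k \<and> s k \<le> 1) \<and> (\<forall>k\<in>{1..<b}. s (Suc k) \<le> s k)}"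

definition is_fixed_point :: "nat \<Rightarrow> real \<Rightarrow> (nat \<Rightarrow> real) \<Rightarrow> bool" where
  "is_fixed_point b lam s \<longleftrightarrow> s \<in> simplexS b \<and> (\<forall>k\<in>{1..b}. drift b lam s k = 0)"

definition sqdist :: "nat \<Rightarrow> (nat \<Rightarrow> real) \<Rightarrow> (nat \<Rightarrow> real) \<Rightarrow> real" where
  "sqdist b s t = (\<Sum>k\<in>{1..b}. (s k - t k)\<^sup>2)"

end

theory Submission
  imports Defs "HOL-Real_Asymp.Real_Asymp"
begin

text \<open>
  Write \<open>q v = sqrt ((v + c) / \<lambda>)\<close>, where \<open>c = \<lambda> * s\<^sup>*\<^sub>b ^ 2\<close> is the overflow of the fluid limit. The fixed
  point satisfies \<open>q s\<^sup>*\<^sub>k\<^sub>+\<^sub>1 = s\<^sup>*\<^sub>k\<close>, so \<open>\<theta>\<^sub>k = q ^^ k - 1\<close> vanishes at \<open>s\<^sup>*\<^sub>k\<close>. For the Lyapunov function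
  \<open>V s = (\<Sum>k. \<integral> \<theta>\<^sub>k s\<^sub>k)\<close> the fluid drift is minus a sum of products
  \<open>(u - s\<^sub>k\<^sub>+\<^sub>1) * (\<theta>\<^sub>k\<^sub>+\<^sub>1 u - \<theta>\<^sub>k\<^sub>+\<^sub>1 s\<^sub>k\<^sub>+\<^sub>1)\<close> with \<open>u = \<lambda> * s\<^sub>k ^ 2 - c\<close>, because \<open>\<theta>\<^sub>k\<^sub>+\<^sub>1 u = \<theta>\<^sub>k s\<^sub>k\<close>; each
  is nonnegative by monotonicity. Concavity of \<open>\<theta>\<^sub>k\<close> bounds the discretisation error by \<open>O (1 / N)\<close> per
  level, hence the stationary mean of the dissipation is \<open>O (b / N)\<close>.

  The slope of \<open>\<theta>\<^sub>k\<close> is at least of order \<open>2 powr (- k)\<close>, and iterating \<open>s\<^sub>k\<^sub>+\<^sub>1 = u - (u - s\<^sub>k\<^sub>+\<^sub>1)\<close> bounds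
  \<open>(s\<^sub>k - s\<^sup>*\<^sub>k) ^ 2\<close> by \<open>4 ^ k\<close> times the dissipation. This is used up to the level \<open>K\<close> with
  \<open>2 ^ K \<approx> N powr (\<alpha> + \<xi>)\<close>; there \<open>s\<^sup>*\<^sub>K \<le> \<lambda> ^ (2 ^ K - 1)\<close> is already negligible, and higher levels are
  controlled by monotonicity in \<open>k\<close>.
\<close>

section \<open>The stationary chain\<close>

lemma finite_jsq_states: "finite (jsq_states N b)"
proof -
  let ?B = "(\<lambda>m. real m / real N) ` {..N}"
  have "jsq_states N b \<subseteq> {f. \<forall>k. (k \<in> {1..b} \<longrightarrow> f k \<in> ?B) \<and> (k \<notin> {1..b} \<longrightarrow> f k = 0)}"
    unfolding jsq_states_def by (auto simp: not_le Suc_le_eq)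
  moreover have "finite \<dots>"
    by (rule finite_set_of_finite_funs) auto
  ultimately show ?thesis by (rule finite_subset)
qed

definition jsq_gen :: "nat \<Rightarrow> nat \<Rightarrow> real \<Rightarrow> ((nat \<Rightarrow> real) \<Rightarrow> real) \<Rightarrow> (nat \<Rightarrow> real) \<Rightarrow> real" where
  "jsq_gen N b lam V s = (\<Sum>y\<in>jsq_states N b - {s}. jsq_rate N b lam s y * (V y - V s))"

text \<open>Exchanging the two summations turns the mean into inflow minus outflow, weighted by
  \<open>V\<close>; global balance cancels these state by state.\<close>

lemma expectation_jsq_gen:
  assumes "jsq_stationary N b lam p"
  shows "measure_pmf.expectation p (jsq_gen N b lam V) = 0"
proof -
  let ?X = "jsq_states N b" and ?r = "jsq_rate N b lam"
  note fin = finite_jsq_states[of N b]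
  have sup: "set_pmf p \<subseteq> ?X"
    and bal: "\<And>x. x \<in> ?X \<Longrightarrow> pmf p x * (\<Sum>y\<in>?X - {x}. ?r x y) = (\<Sum>y\<in>?X - {x}. pmf p y * ?r y x)"
    using assms unfolding jsq_stationary_def by auto
  define g where "g x y = (if x = y then 0 else pmf p x * ?r x y)" for x y
  have diag: "(\<Sum>y\<in>?X - {x}. pmf p x * ?r x y * h y) = (\<Sum>y\<in>?X. g x y * h y)" if "x \<in> ?X" for x h
    by (rule sum.mono_neutral_cong_left) (use fin in \<open>auto simp: g_def\<close>)
  have diag': "(\<Sum>y\<in>?X - {x}. pmf p y * ?r y x) = (\<Sum>y\<in>?X. g y x)" if "x \<in> ?X" for x
    by (rule sum.mono_neutral_cong_left) (use fin in \<open>auto simp: g_def\<close>)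
  have "measure_pmf.expectation p (jsq_gen N b lam V) = (\<Sum>x\<in>?X. pmf p x * jsq_gen N b lam V x)"
    using integral_measure_pmf_real[OF fin, of p "jsq_gen N b lam V"] sup
    by (auto simp: mult.commute)
  also have "\<dots> = (\<Sum>x\<in>?X. \<Sum>y\<in>?X. g x y * (V y - V x))"
    by (intro sum.cong refl) (simp add: jsq_gen_def sum_distrib_left mult.assoc[symmetric] diag)
  also have "\<dots> = (\<Sum>x\<in>?X. \<Sum>y\<in>?X. g x y * V y) - (\<Sum>x\<in>?X. V x * (\<Sum>y\<in>?X. g x y))"
    by (simp add: right_diff_distrib sum_subtractf sum_distrib_left mult.commute)
  also have "(\<Sum>x\<in>?X. \<Sum>y\<in>?X. g x y * V y) = (\<Sum>x\<in>?X. V x * (\<Sum>y\<in>?X. g y x))"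
    by (subst sum.swap) (simp add: sum_distrib_left mult.commute)
  also have "\<dots> = (\<Sum>x\<in>?X. V x * (\<Sum>y\<in>?X. g x y))"
  proof (intro sum.cong refl)
    fix x assume x: "x \<in> ?X"
    show "V x * (\<Sum>y\<in>?X. g y x) = V x * (\<Sum>y\<in>?X. g x y)"
      using bal[OF x] diag[OF x, of "\<lambda>_. 1"] diag'[OF x] by (simp add: sum_distrib_left)
  qed
  finally show ?thesis by simp
qed

section \<open>Grid states, admissible jumps and the generator\<close>

lemma sext_grid:
  assumes "s \<in> jsq_states N b" "N \<ge> 1"
  obtains m :: nat where "m \<le> N" "sext b s k = real m / real N"
proof -
  consider "k = 0" | "k \<in> {1..b}" | "k > b" by fastforce
  then show ?thesis
  proof cases
    case 1
    then show ?thesis using that[of N] assms by (simp add: sext_def)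
  next
    case 2
    then obtain m where "m \<le> N" "s k = real m / real N"
      using assms unfolding jsq_states_def by blast
    then show ?thesis using that[of m] 2 by (simp add: sext_def)
  next
    case 3
    then show ?thesis using that[of 0] by (simp add: sext_def)
  qed
qed

lemma sext_bounds:
  assumes "s \<in> jsq_states N b" "N \<ge> 1"
  shows "0 \<le> sext b s k" "sext b s k \<le> 1"
proof -
  obtain m where "m \<le> N" "sext b s k = real m / real N" using sext_grid[OF assms] .
  then show "0 \<le> sext b s k" "sext b s k \<le> 1" using assms(2) by auto
qed

lemma sext_Suc_le:
  assumes "s \<in> jsq_states N b" "N \<ge> 1"
  shows "sext b s (Suc k) \<le> sext b s k"
proof -
  consider "k = 0" | "k \<in> {1..<b}" | "k \<ge> b" "k > 0" by fastforce
  then show ?thesis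
  proof cases
    case 1
    then show ?thesis using sext_bounds(2)[OF assms, of 1] by (simp add: sext_def[of b s 0])
  next
    case 2
    then show ?thesis using assms by (auto simp: jsq_states_def sext_def)
  next
    case 3
    then show ?thesis using sext_bounds[OF assms, of k] by (simp add: sext_def)
  qed
qed

lemma sext_antimono:
  assumes "s \<in> jsq_states N b" "N \<ge> 1" "i \<le> j"
  shows "sext b s j \<le> sext b s i"
  using lift_Suc_antimono_le[of "sext b s", OF sext_Suc_le[OF assms(1,2)]] assms(3) .

text \<open>Distinct grid values differ by at least \<open>1 / N\<close>, so a strict inequality
  leaves room for a whole jump.\<close>

lemma jsq_states_up:
  assumes s: "s \<in> jsq_states N b" and N: "N \<ge> 1" and k: "k \<in> {1..b}"
    and less: "sext b s k < sext b s (k - 1)"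
  shows "(\<lambda>j. s j + unitv k j / real N) \<in> jsq_states N b"
proof -
  obtain m where m: "m \<le> N" "sext b s k = real m / real N" using sext_grid[OF s N] .
  obtain l where l: "l \<le> N" "sext b s (k - 1) = real l / real N" using sext_grid[OF s N] .
  have ml: "Suc m \<le> l" using less m l N by (simp add: divide_less_cancel)
  have up: "s k + 1 / real N = real (Suc m) / real N"
    using m k by (simp add: sext_def add_divide_distrib)
  have le: "s k + 1 / real N \<le> sext b s (k - 1)"
    unfolding up l(2) using ml by (simp add: divide_right_mono)
  have "\<exists>m\<le>N. s j + unitv k j / real N = real m / real N" if "j \<in> {1..b}" for j
  proof (cases "j = k")
    case True
    then show ?thesis using up ml l(1) by (intro exI[of _ "Suc m"]) (auto simp: unitv_def)
  next
    case False
    then show ?thesis using that s by (auto simp: jsq_states_def unitv_def)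
  qed
  moreover have "s (Suc j) + unitv k (Suc j) / real N \<le> s j + unitv k j / real N"
    if j: "j \<in> {1..<b}" for j
  proof (cases "Suc j = k")
    case True
    then show ?thesis using le j by (auto simp: unitv_def sext_def)
  next
    case False
    then have "s (Suc j) \<le> s j" "unitv k (Suc j) \<le> unitv k j"
      using s j by (auto simp: jsq_states_def unitv_def)
    then show ?thesis by (intro add_mono divide_right_mono) auto
  qed
  ultimately show ?thesis
    using s k unfolding jsq_states_def by (auto simp: unitv_def)
qed

lemma jsq_states_down:
  assumes s: "s \<in> jsq_states N b" and N: "N \<ge> 1" and k: "k \<in> {1..b}"
    and less: "sext b s (Suc k) < sext b s k"
  shows "(\<lambda>j. s j - unitv k j / real N) \<in> jsq_states N b"
proof -
  obtain m where m: "m \<le> N" "sext b s k = real m / real N" using sext_grid[OF s N] .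
  obtain l where l: "l \<le> N" "sext b s (Suc k) = real l / real N" using sext_grid[OF s N] .
  have ml: "l \<le> m - 1" "m \<ge> 1" using less m l N by (auto simp: divide_less_cancel)
  have dn: "s k - 1 / real N = real (m - 1) / real N"
    using m k ml(2) by (simp add: sext_def diff_divide_distrib of_nat_diff)
  have le: "sext b s (Suc k) \<le> s k - 1 / real N"
    unfolding dn l(2) using ml by (simp add: divide_right_mono)
  have "\<exists>m\<le>N. s j - unitv k j / real N = real m / real N" if "j \<in> {1..b}" for j
  proof (cases "j = k")
    case True
    then show ?thesis using dn m(1) by (intro exI[of _ "m - 1"]) (auto simp: unitv_def)
  next
    case False
    then show ?thesis using that s by (auto simp: jsq_states_def unitv_def)
  qed
  moreover have "s (Suc j) - unitv k (Suc j) / real N \<le> s j - unitv k j / real N"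
    if j: "j \<in> {1..<b}" for j
  proof (cases "j = k")
    case True
    then show ?thesis using le j by (auto simp: unitv_def sext_def)
  next
    case False
    then have "s (Suc j) \<le> s j" "unitv k j \<le> unitv k (Suc j)"
      using s j by (auto simp: jsq_states_def unitv_def)
    then show ?thesis by (intro diff_mono divide_right_mono) auto
  qed
  ultimately show ?thesis
    using s k unfolding jsq_states_def by (auto simp: unitv_def)
qed

text \<open>A jump that would leave the state space has rate 0, so the sum over target states
  reduces to a sum over jump directions.\<close>

lemma jsq_gen_eq:
  assumes s: "s \<in> jsq_states N b" and N: "N \<ge> 1"
  shows "jsq_gen N b lam V s = (\<Sum>k\<in>{1..b}.
     lam * real N * ((sext b s (k-1))\<^sup>2 - (sext b s k)\<^sup>2) * (V (\<lambda>j. s j + unitv k j / real N) - V s)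
     + real N * (sext b s k - sext b s (Suc k)) * (V (\<lambda>j. s j - unitv k j / real N) - V s))"
proof -
  let ?Y = "jsq_states N b - {s}"
  define up where "up k = (\<lambda>j. s j + unitv k j / real N)" for k
  define dn where "dn k = (\<lambda>j. s j - unitv k j / real N)" for k
  define u where "u k = lam * real N * ((sext b s (k-1))\<^sup>2 - (sext b s k)\<^sup>2)" for k
  define d where "d k = real N * (sext b s k - sext b s (Suc k))" for k
  have fin: "finite ?Y" using finite_jsq_states by simp
  have ne: "up k \<noteq> s" "dn k \<noteq> s" for k
  proof -
    have "up k k \<noteq> s k" "dn k k \<noteq> s k" using N by (auto simp: up_def dn_def unitv_def)
    then show "up k \<noteq> s" "dn k \<noteq> s" by auto
  qed
  have U: "up k \<in> ?Y \<or> u k = 0" if "k \<in> {1..b}" for k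
  proof (cases "sext b s k < sext b s (k - 1)")
    case True
    then show ?thesis using jsq_states_up[OF s N that] ne by (auto simp: up_def)
  next
    case False
    then have "sext b s k = sext b s (k - 1)"
      using sext_antimono[OF s N, of "k - 1" k] by simp
    then show ?thesis by (simp add: u_def)
  qed
  have D: "dn k \<in> ?Y \<or> d k = 0" if "k \<in> {1..b}" for k
  proof (cases "sext b s (Suc k) < sext b s k")
    case True
    then show ?thesis using jsq_states_down[OF s N that] ne by (auto simp: dn_def)
  next
    case False
    then have "sext b s k = sext b s (Suc k)"
      using sext_Suc_le[OF s N, of k] by simp
    then show ?thesis by (simp add: d_def)
  qed
  have one: "(\<Sum>y\<in>?Y. (if y = z then r else 0) * (V y - V s)) = r * (V z - V s)"
    if "z \<in> ?Y \<or> r = 0" for z r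
  proof -
    have "(\<Sum>y\<in>?Y. (if y = z then r else 0) * (V y - V s))
        = (\<Sum>y\<in>?Y. if y = z then r * (V z - V s) else 0)"
      by (intro sum.cong) auto
    then show ?thesis using that fin by (auto simp: sum.delta)
  qed
  have "jsq_gen N b lam V s = (\<Sum>y\<in>?Y. (\<Sum>k\<in>{1..b}.
      (if y = up k then u k else 0) * (V y - V s) + (if y = dn k then d k else 0) * (V y - V s)))"
    unfolding jsq_gen_def jsq_rate_def up_def dn_def u_def d_def
    by (simp add: sum_distrib_right distrib_right)
  also have "\<dots> = (\<Sum>k\<in>{1..b}. \<Sum>y\<in>?Y.
      (if y = up k then u k else 0) * (V y - V s) + (if y = dn k then d k else 0) * (V y - V s))"
    by (rule sum.swap)
  also have "\<dots> = (\<Sum>k\<in>{1..b}. u k * (V (up k) - V s) + d k * (V (dn k) - V s))"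
  proof (intro sum.cong refl)
    fix k assume k: "k \<in> {1..b}"
    show "(\<Sum>y\<in>?Y. (if y = up k then u k else 0) * (V y - V s) + (if y = dn k then d k else 0) * (V y - V s))
      = u k * (V (up k) - V s) + d k * (V (dn k) - V s)"
      using one[OF U[OF k]] one[OF D[OF k]] by (simp add: sum.distrib)
  qed
  finally show ?thesis unfolding up_def dn_def u_def d_def .
qed

section \<open>Separable functions on the grid\<close>

text \<open>A discrete antiderivative: its increments over one grid step are the values of \<open>h\<close>.\<close>

definition grid_sum :: "nat \<Rightarrow> (real \<Rightarrow> real) \<Rightarrow> real \<Rightarrow> real" where
  "grid_sum N h v = (\<Sum>i\<in>{1..nat (round (real N * v))}. h (real i / real N)) / real N"

lemma grid_sum_step:
  assumes "N \<ge> 1"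
  shows "real N * (grid_sum N h (real m / real N + 1 / real N) - grid_sum N h (real m / real N))
    = h (real m / real N + 1 / real N)"
proof -
  have "real N * (real m / real N + 1 / real N) = real (Suc m)" "real N * (real m / real N) = real m"
    using assms by (auto simp: field_simps)
  moreover have "nat (round (real n)) = n" for n
    by simp
  moreover have "real m / real N + 1 / real N = real (Suc m) / real N"
    by (simp add: add_divide_distrib)
  ultimately show ?thesis
    unfolding grid_sum_def using assms by (simp only:) (simp add: field_simps)
qed

definition grid_pot :: "nat \<Rightarrow> nat \<Rightarrow> (nat \<Rightarrow> real \<Rightarrow> real) \<Rightarrow> (nat \<Rightarrow> real) \<Rightarrow> real" where
  "grid_pot N b h s = (\<Sum>k\<in>{1..b}. grid_sum N (h k) (s k))"

lemma grid_pot_change: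
  assumes "k \<in> {1..b}" "\<And>j. j \<noteq> k \<Longrightarrow> t j = s j"
  shows "grid_pot N b h t - grid_pot N b h s = grid_sum N (h k) (t k) - grid_sum N (h k) (s k)"
proof -
  have "(\<Sum>j\<in>{1..b} - {k}. grid_sum N (h j) (t j)) = (\<Sum>j\<in>{1..b} - {k}. grid_sum N (h j) (s j))"
    using assms(2) by (intro sum.cong) auto
  then show ?thesis
    unfolding grid_pot_def using sum.remove[OF _ assms(1)] by (metis (no_types, lifting) add_diff_cancel_right finite_atLeastAtMost)
qed

text \<open>An arrival picks up \<open>h k\<close> at the value after the jump, a departure picks up
  \<open>- h k\<close> at the value before it.\<close>

lemma jsq_gen_grid_pot:
  assumes s: "s \<in> jsq_states N b" and N: "N \<ge> 1"
  shows "jsq_gen N b lam (grid_pot N b h) s = (\<Sum>k\<in>{1..b}.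
     lam * ((sext b s (k-1))\<^sup>2 - (sext b s k)\<^sup>2) * h k (sext b s k + 1 / real N)
     - (sext b s k - sext b s (Suc k)) * h k (sext b s k))"
  unfolding jsq_gen_eq[OF s N]
proof (intro sum.cong refl)
  fix k assume k: "k \<in> {1..b}"
  let ?V = "grid_pot N b h"
  obtain m where m: "m \<le> N" "sext b s k = real m / real N" using sext_grid[OF s N] .
  have sk: "s k = sext b s k" using k by (simp add: sext_def)
  have "?V (\<lambda>j. s j + unitv k j / real N) - ?V s
      = grid_sum N (h k) (s k + 1 / real N) - grid_sum N (h k) (s k)"
    by (subst grid_pot_change[OF k]) (auto simp: unitv_def)
  then have up: "real N * (?V (\<lambda>j. s j + unitv k j / real N) - ?V s) = h k (sext b s k + 1 / real N)"
    using grid_sum_step[OF N, of "h k" m] m sk by simp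
  have dn: "(sext b s k - sext b s (Suc k)) * (real N * (?V (\<lambda>j. s j - unitv k j / real N) - ?V s))
      = - (sext b s k - sext b s (Suc k)) * h k (sext b s k)"
  \<comment> \<open>At 0 there is no grid step downwards, but the departure rate vanishes
    there.\<close>
  proof (cases "m = 0")
    case True
    then have "sext b s k = 0" using m by simp
    moreover have "sext b s (Suc k) = 0"
      using sext_bounds(1)[OF s N, of "Suc k"] sext_Suc_le[OF s N, of k] calculation by simp
    ultimately show ?thesis by simp
  next
    case False
    then obtain n where n: "m = Suc n" using not0_implies_Suc by blast
    have e: "s k = real n / real N + 1 / real N" "s k - 1 / real N = real n / real N"
      using m sk n by (auto simp: add_divide_distrib)
    have "?V (\<lambda>j. s j - unitv k j / real N) - ?V s
        = grid_sum N (h k) (s k - 1 / real N) - grid_sum N (h k) (s k)"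
      by (subst grid_pot_change[OF k]) (auto simp: unitv_def)
    then have "real N * (?V (\<lambda>j. s j - unitv k j / real N) - ?V s) = - h k (sext b s k)"
      using grid_sum_step[OF N, of "h k" n, folded e(1), folded e(2)] by (simp add: sk right_diff_distrib)
    then show ?thesis by (simp only: mult_minus_left mult_minus_right)
  qed
  show "lam * real N * ((sext b s (k-1))\<^sup>2 - (sext b s k)\<^sup>2) * (?V (\<lambda>j. s j + unitv k j / real N) - ?V s)
     + real N * (sext b s k - sext b s (Suc k)) * (?V (\<lambda>j. s j - unitv k j / real N) - ?V s)
     = lam * ((sext b s (k-1))\<^sup>2 - (sext b s k)\<^sup>2) * h k (sext b s k + 1 / real N)
     - (sext b s k - sext b s (Suc k)) * h k (sext b s k)"
    unfolding up[symmetric] using dn by (simp add: algebra_simps)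
qed

section \<open>Pulling components back to level zero\<close>

locale jsq_fixed_point =
  fixes b :: nat and lam :: real and sstar :: "nat \<Rightarrow> real"
  assumes b: "b \<ge> 1" and lam: "1/2 \<le> lam" "lam \<le> 1" and fp: "is_fixed_point b lam sstar"
begin

abbreviation "st \<equiv> sext b sstar"

text \<open>The stationary flux of the fluid limit, which leaves the system by overflow at level \<open>b\<close>.\<close>

definition "c = lam * (sstar b)\<^sup>2"

text \<open>The inverse, on nonnegative arguments, of the level map taking \<open>x\<close> to
  \<open>lam * x^2 - c\<close>.\<close>

definition "q v = sqrt ((v + c) / lam)"

text \<open>The function \<theta> of level \<open>k\<close> in the overview is
  \<open>F k v - 1\<close>.\<close>

definition "F k = q ^^ k"

lemma lam_pos: "lam > 0"
  using lam by simp

lemma c_nonneg: "c \<ge> 0"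
  using lam_pos by (simp add: c_def)

lemma F_0 [simp]: "F 0 v = v"
  by (simp add: F_def)

lemma F_Suc: "F (Suc k) v = F k (q v)"
  unfolding F_def funpow_Suc_right by simp

lemma st_0 [simp]: "st 0 = 1"
  and st_Suc_b: "st (Suc b) = 0"
  and st_b: "st b = sstar b"
  using b by (simp_all add: sext_def)

lemma st_nonneg: "st k \<ge> 0"
  and st_le_1: "st k \<le> 1"
proof -
  have "k \<in> {1..b} \<Longrightarrow> 0 \<le> sstar k \<and> sstar k \<le> 1"
    using fp unfolding is_fixed_point_def simplexS_def by blast
  then show "st k \<ge> 0" "st k \<le> 1" by (auto simp: sext_def)
qed

text \<open>Zero drift equates the fluxes of neighbouring levels; the induction runs down from level
  \<open>b\<close>, where the flux is \<open>c\<close> by definition.\<close>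

lemma st_flux:
  assumes "k \<le> b"
  shows "lam * (st k)\<^sup>2 - st (Suc k) = c"
  using assms
proof (induction rule: inc_induct)
  case base
  show ?case by (simp add: st_Suc_b st_b c_def)
next
  case (step k)
  then have "drift b lam sstar (Suc k) = 0" using fp by (auto simp: is_fixed_point_def)
  then show ?case using step.IH by (simp add: drift_def algebra_simps)
qed

lemma st_Suc: "k \<le> b \<Longrightarrow> st (Suc k) = lam * (st k)\<^sup>2 - c"
  using st_flux[of k] by simp

text \<open>Each level loses at least \<open>c\<close>, since \<open>lam * x^2 <= x\<close> on the
  unit interval, and the total fall from 1 is at most 1.\<close>

lemma b_c_le_1: "real b * c \<le> 1"
proof -
  have "st k \<le> 1 - real k * c" if "k \<le> b" for k
    using that
  proof (induction k)
    case (Suc k)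
    have "lam * (st k)\<^sup>2 \<le> 1 * (st k * 1)"
      unfolding power2_eq_square using lam st_nonneg[of k] st_le_1[of k] by (intro mult_mono) auto
    then show ?case using Suc st_Suc[of k] by (simp add: algebra_simps)
  qed simp
  from this[of b] st_nonneg[of b] show ?thesis by simp
qed

lemma c_le_1: "c \<le> 1"
proof -
  have "1 * c \<le> real b * c" using b c_nonneg by (intro mult_right_mono) auto
  then show ?thesis using b_c_le_1 by simp
qed

lemma st_Suc_le: "k \<le> b \<Longrightarrow> st (Suc k) \<le> st k"
proof -
  assume "k \<le> b"
  have "lam * (st k)\<^sup>2 \<le> 1 * (st k * 1)"
    unfolding power2_eq_square using lam st_nonneg[of k] st_le_1[of k] by (intro mult_mono) auto
  then show ?thesis using st_Suc[OF \<open>k \<le> b\<close>] c_nonneg by simp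
qed

lemma st_antimono:
  assumes "i \<le> j" "j \<le> b"
  shows "st j \<le> st i"
  using assms
proof (induction rule: dec_induct)
  case (step k)
  then show ?case using st_Suc_le[of k] by simp
qed simp

text \<open>The next level is at most \<open>lam\<close> times the square of the present one, so the
  exponent \<open>e\<close> becomes \<open>2 * e + 1\<close>.\<close>

lemma st_le_power: "k \<le> b \<Longrightarrow> st k \<le> lam ^ (2 ^ k - 1)"
proof (induction k)
  case (Suc k)
  have "st (Suc k) \<le> lam * (st k)\<^sup>2" using st_Suc[of k] Suc.prems c_nonneg by simp
  also have "\<dots> \<le> lam * (lam ^ (2 ^ k - 1))\<^sup>2"
    using Suc st_nonneg[of k] lam_pos by (intro mult_left_mono power_mono) auto
  also have "\<dots> = lam ^ Suc ((2 ^ k - 1) * 2)" by (simp add: power_mult)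
  also have "Suc ((2 ^ k - 1) * 2) = 2 ^ Suc k - 1"
    by (cases "2 ^ k :: nat") simp_all
  finally show ?case .
qed simp

section \<open>The inverse level map and its iterates: order, range, slope and concavity\<close>

lemma q_nonneg: "v \<ge> - c \<Longrightarrow> q v \<ge> 0"
  using lam_pos unfolding q_def by (intro real_sqrt_ge_zero divide_nonneg_pos) auto

lemma q_sq: "v \<ge> - c \<Longrightarrow> lam * (q v)\<^sup>2 = v + c"
proof -
  assume "v \<ge> - c"
  then have "(v + c) / lam \<ge> 0" using lam_pos by (intro divide_nonneg_pos) auto
  then show ?thesis using lam_pos unfolding q_def by (subst real_sqrt_pow2) auto
qed

lemma q_mono: "v \<le> w \<Longrightarrow> q v \<le> q w"
  using lam_pos by (simp add: q_def divide_right_mono)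

lemma q_of_sq: "x \<ge> 0 \<Longrightarrow> q (lam * x\<^sup>2 - c) = x"
  using lam_pos by (simp add: q_def)

lemma F_mono: "v \<le> w \<Longrightarrow> F k v \<le> F k w"
proof (induction k arbitrary: v w)
  case (Suc k)
  show ?case unfolding F_Suc by (intro Suc.IH q_mono Suc.prems)
qed simp

lemma F_nonneg: "v \<ge> 0 \<Longrightarrow> F k v \<ge> 0"
proof (induction k arbitrary: v)
  case (Suc k)
  then show ?case using q_nonneg[of v] c_nonneg unfolding F_Suc by (intro Suc.IH) auto
qed simp

lemma F_st: "k \<le> b \<Longrightarrow> F k (st k) = 1"
  by (induction k) (simp_all add: F_Suc st_Suc q_of_sq st_nonneg)

text \<open>The bound \<open>(1 + c) / lam\<close> is preserved by \<open>q\<close>; it is taken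
  large enough to admit the shifted values \<open>x + 1 / N\<close> later on.\<close>

lemma q_le:
  assumes "- c \<le> v" "v \<le> (1 + c) / lam"
  shows "q v \<le> (1 + c) / lam"
proof -
  have "(v + c) / lam \<le> ((1 + c) / lam)\<^sup>2"
  proof -
    have "lam * (v + c) \<le> (1 + c) + lam * c"
      using assms lam_pos by (simp add: field_simps)
    also have "lam * c \<le> c" using lam c_nonneg by (simp add: mult_left_le_one_le)
    also have "1 + c + c \<le> (1 + c)\<^sup>2" by (simp add: power2_eq_square algebra_simps)
    finally have "lam * (v + c) / lam\<^sup>2 \<le> (1 + c)\<^sup>2 / lam\<^sup>2" by (intro divide_right_mono) auto
    then show ?thesis using lam_pos by (simp add: power_divide power2_eq_square)
  qed
  then show ?thesis unfolding q_def using lam_pos c_nonneg by (intro real_le_lsqrt) auto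
qed

lemma F_le:
  assumes "0 \<le> v" "v \<le> (1 + c) / lam"
  shows "F k v \<le> (1 + c) / lam"
  using assms
proof (induction k arbitrary: v)
  case (Suc k)
  then show ?case using q_le[of v] q_nonneg[of v] c_nonneg by (simp add: F_Suc)
qed simp

text \<open>The factor 2 is the slope of the fluid map at saturation; the overflow inflates it to
  \<open>2 * (1 + c)\<close>, which is harmless over \<open>b\<close> levels because \<open>b * c \<le> 1\<close>.\<close>

lemma q_slope:
  assumes "- c \<le> w" "w \<le> u" "u \<le> (1 + c) / lam"
  shows "u - w \<le> 2 * (1 + c) * (q u - q w)"
proof -
  have "q u \<le> (1 + c) / lam" "q w \<le> (1 + c) / lam"
    using q_le[of u] q_le[of w] assms by linarith+
  then have le: "lam * q u \<le> 1 + c" "lam * q w \<le> 1 + c"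
    using lam_pos by (simp_all add: pos_le_divide_eq mult.commute)
  have "u - w = lam * (q u)\<^sup>2 - lam * (q w)\<^sup>2" using q_sq[of u] q_sq[of w] assms by simp
  also have "\<dots> = (lam * q u + lam * q w) * (q u - q w)"
    by (simp add: power2_eq_square algebra_simps)
  also have "\<dots> \<le> (2 * (1 + c)) * (q u - q w)"
    using le q_mono[OF assms(2)] by (intro mult_right_mono) auto
  finally show ?thesis .
qed

lemma F_slope:
  assumes "0 \<le> w" "w \<le> u" "u \<le> (1 + c) / lam"
  shows "u - w \<le> (2 * (1 + c)) ^ k * (F k u - F k w)"
  using assms
proof (induction k arbitrary: u w)
  case (Suc k)
  have cw: "- c \<le> w" "- c \<le> u" using Suc.prems c_nonneg by auto
  have "u - w \<le> 2 * (1 + c) * (q u - q w)" using q_slope cw Suc.prems by blast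
  also have "\<dots> \<le> 2 * (1 + c) * ((2 * (1 + c)) ^ k * (F k (q u) - F k (q w)))"
    using Suc.IH[of "q w" "q u"] q_nonneg cw q_mono q_le Suc.prems c_nonneg
    by (intro mult_left_mono) auto
  finally show ?case by (simp add: F_Suc mult.assoc)
qed simp

lemma slope_const_le:
  assumes "k \<le> b"
  shows "(2 * (1 + c)) ^ k \<le> 3 * 2 ^ k"
proof -
  have "(1 + c) ^ k \<le> exp c ^ k"
    using c_nonneg exp_ge_add_one_self[of c] by (intro power_mono) auto
  also have "\<dots> = exp (real k * c)" by (simp add: exp_of_nat_mult)
  also have "real k * c \<le> real b * c" using assms c_nonneg by (intro mult_right_mono) auto
  then have "exp (real k * c) \<le> exp 1" using b_c_le_1 by simp
  also have "exp (1::real) \<le> 3" by (rule exp_le)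
  finally show ?thesis unfolding power_mult_distrib by simp
qed

text \<open>The arguments may be negative, outside the range of \<open>F_slope\<close>; the first
  application of \<open>q\<close> makes them nonnegative. The product is symmetric in
  \<open>u\<close> and \<open>w\<close>, and \<open>6 * 2 ^ k\<close> is
  \<open>3 * 2 ^ Suc k\<close>.\<close>

lemma F_Suc_slope_sq:
  assumes "- c \<le> u" "u \<le> (1 + c) / lam" "- c \<le> w" "w \<le> (1 + c) / lam" "k < b"
  shows "(u - w)\<^sup>2 \<le> 6 * 2 ^ k * ((u - w) * (F (Suc k) u - F (Suc k) w))"
proof -
  have slope: "y - x \<le> (2 * (1 + c)) ^ Suc k * (F (Suc k) y - F (Suc k) x)"
    if "- c \<le> x" "x \<le> y" "y \<le> (1 + c) / lam" for x y
  proof -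
    have "y - x \<le> 2 * (1 + c) * (q y - q x)" using q_slope that by blast
    also have "\<dots> \<le> 2 * (1 + c) * ((2 * (1 + c)) ^ k * (F k (q y) - F k (q x)))"
      using F_slope[of "q x" "q y" k] q_nonneg[of x] q_mono[of x y] q_le[of y] that c_nonneg
      by (intro mult_left_mono) auto
    finally show ?thesis by (simp add: F_Suc mult.assoc)
  qed
  have main: "(y - x)\<^sup>2 \<le> 6 * 2 ^ k * ((y - x) * (F (Suc k) y - F (Suc k) x))"
    if "- c \<le> x" "x \<le> y" "y \<le> (1 + c) / lam" for x y
  proof -
    have "y - x \<le> (2 * (1 + c)) ^ Suc k * (F (Suc k) y - F (Suc k) x)"
      using slope that by blast
    also have "\<dots> \<le> 3 * 2 ^ Suc k * (F (Suc k) y - F (Suc k) x)"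
      using slope_const_le[of "Suc k"] F_mono[OF that(2)] assms(5) by (intro mult_right_mono) auto
    finally have "(y - x) * (y - x) \<le> (y - x) * (3 * 2 ^ Suc k * (F (Suc k) y - F (Suc k) x))"
      using that by (intro mult_left_mono) auto
    then show ?thesis by (simp add: power2_eq_square algebra_simps)
  qed
  show ?thesis
  proof (cases "w \<le> u")
    case True
    then show ?thesis using main assms by blast
  next
    case False
    have "(u - w) * (F (Suc k) u - F (Suc k) w) = (w - u) * (F (Suc k) w - F (Suc k) u)"
      by (simp add: algebra_simps)
    then show ?thesis using main[of u w] assms False power2_commute[of u w] by simp
  qed
qed

text \<open>Concavity of \<open>F (Suc k)\<close>: the increment over \<open>[v, v + h]\<close> against the chord from the left end
  \<open>- c\<close> of the domain.\<close>

lemma F_chord: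
  assumes "0 \<le> v" "0 \<le> h"
  shows "(v + c) * (F (Suc k) (v + h) - F (Suc k) v) \<le> h * F (Suc k) v"
proof -
  \<comment> \<open>With \<open>v + c = lam * w^2\<close> the chord inequality of \<open>F k\<close>
    from 0 becomes that of \<open>F (Suc k)\<close> from \<open>- c\<close>, because
    \<open>h = lam * (2 * w * g + g^2) >= lam * w * g\<close>.\<close>
  have step: "(v + c) * (F (Suc k) (v + h) - F (Suc k) v) \<le> h * F (Suc k) v"
    if h: "h \<ge> 0" and v: "v \<ge> 0"
      and IH: "\<And>w h. w \<ge> 0 \<Longrightarrow> h \<ge> 0 \<Longrightarrow> w * (F k (w + h) - F k w) \<le> h * F k w" for k v h
  proof -
    define w where "w = q v"
    define g where "g = q (v + h) - w"
    have w: "w \<ge> 0" and g: "g \<ge> 0"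
      using v h c_nonneg q_nonneg[of v] q_mono[of v "v + h"] by (auto simp: w_def g_def)
    have wv: "lam * w\<^sup>2 = v + c" "lam * (w + g)\<^sup>2 = v + h + c"
      using v h c_nonneg q_sq[of v] q_sq[of "v + h"] by (auto simp: w_def g_def)
    have "h = lam * (2 * w * g + g\<^sup>2)"
      using wv by (simp add: power2_eq_square algebra_simps)
    moreover have "lam * (w * g) \<le> lam * (2 * w * g + g\<^sup>2)"
      using w g lam_pos by (intro mult_left_mono) auto
    ultimately have wg: "lam * w * g \<le> h" by simp
    have "(v + c) * (F (Suc k) (v + h) - F (Suc k) v) = lam * w * (w * (F k (w + g) - F k w))"
      using wv(1) by (simp add: F_Suc w_def g_def power2_eq_square)
    also have "\<dots> \<le> lam * w * (g * F k w)"
      using IH[OF w g] w lam_pos by (intro mult_left_mono) auto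
    also have "\<dots> \<le> h * F k w"
      using wg F_nonneg[OF w, of k] by (simp add: mult.assoc[symmetric] mult_right_mono)
    finally show ?thesis by (simp add: F_Suc w_def)
  qed
  \<comment> \<open>Weakening \<open>v + c\<close> to \<open>v\<close> closes the induction; a last
    use of \<open>step\<close> recovers the sharper form.\<close>
  have chord: "v * (F k (v + h) - F k v) \<le> h * F k v" if "v \<ge> 0" "h \<ge> 0" for v h k
    using that
  proof (induction k arbitrary: v h)
    case (Suc k)
    have "v * (F (Suc k) (v + h) - F (Suc k) v) \<le> (v + c) * (F (Suc k) (v + h) - F (Suc k) v)"
      using c_nonneg Suc.prems F_mono[of v "v + h" "Suc k"] by (intro mult_right_mono) auto
    then show ?case using step[OF Suc.prems(2,1) Suc.IH] by linarith
  qed simp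
  show ?thesis
    using step[OF assms(2,1)] chord by blast
qed

section \<open>Dissipation\<close>

text \<open>The shift by \<open>1 / N\<close> comes from arrivals, which see \<open>F\<close> after
  the jump. Monotonicity of \<open>F\<close> makes each summand nonnegative.\<close>

definition "diss N s = (\<Sum>j<b. (lam * (sext b s j)\<^sup>2 - c - (sext b s (Suc j) + 1 / real N))
  * (F (Suc j) (lam * (sext b s j)\<^sup>2 - c) - F (Suc j) (sext b s (Suc j) + 1 / real N)))"

text \<open>Summation by parts: each level contributes minus a dissipation term, minus a telescoping
  difference, plus an error of at most \<open>8 / N\<close>. The assumption on \<open>lam\<close>
  keeps \<open>x + 1 / N\<close> in the range where \<open>F\<close> is at most 4.\<close>

lemma jsq_gen_le_diss:
  assumes s: "s \<in> jsq_states N b" and N: "N \<ge> 1" and lamN: "lam * (1 + 1 / real N) \<le> 1"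
  shows "jsq_gen N b lam (grid_pot N b (\<lambda>k v. F k v - 1)) s \<le> 8 * real b / real N - diss N s"
proof -
  define e where "e = 1 / real N"
  define x where "x k = sext b s k" for k
  define A where "A k = lam * (x k)\<^sup>2" for k
  define t where "t k = F k (x k) - 1" for k
  define tp where "tp k = F k (x k + e) - 1" for k
  \<comment> \<open>The excess of the flux over \<open>c\<close>, weighted by \<open>t\<close>. It
    vanishes at level 0, where \<open>t\<close> does, and at level \<open>b\<close> monotonicity of
    \<open>F\<close> makes it nonnegative.\<close>
  define g where "g k = (A k - (x (Suc k) + c)) * t k" for k
  define d where "d j = (A j - c - (x (Suc j) + e)) * (F (Suc j) (A j - c) - F (Suc j) (x (Suc j) + e))" for j
  have e: "e \<ge> 0" "lam * (1 + e) \<le> 1" using N lamN by (auto simp: e_def)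
  have x: "0 \<le> x k" "x k \<le> 1" for k using sext_bounds[OF s N] by (auto simp: x_def)
  have x0: "x 0 = 1" and xb: "x (Suc b) = 0" by (auto simp: x_def sext_def)
  have A: "A k \<ge> 0" for k using lam_pos by (simp add: A_def)
  have FA: "F (Suc k) (A k - c) = F k (x k)" for k
    unfolding A_def F_Suc by (simp add: q_of_sq x)
  have F_ub: "F k v \<le> 4" if "0 \<le> v" "v \<le> 1 + e" for k v
  proof -
    have "1 + e \<le> (1 + c) / lam" using e lam_pos c_nonneg by (simp add: pos_le_divide_eq mult.commute)
    then have "F k v \<le> (1 + c) / lam" using that by (intro F_le) auto
    also have "\<dots> \<le> 2 / (1/2)" using lam c_le_1 c_nonneg by (intro frac_le) auto
    finally show ?thesis by simp
  qed
  \<comment> \<open>Two errors of at most \<open>4 * e\<close> each: the increment of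
    \<open>F\<close>, controlled by \<open>F_chord\<close>, and the shift by \<open>e\<close> inside
    \<open>d j\<close>.\<close>
  have bracket: "(A j - A (Suc j)) * tp (Suc j) - (x (Suc j) - x (Suc (Suc j))) * t (Suc j)
      \<le> 8 * e - d j - (g (Suc j) - g j)" if "j < b" for j
  proof -
    let ?v = "x (Suc j)" and ?G = "F (Suc j)"
    have "t (Suc j) \<le> tp (Suc j)" using e F_mono by (simp add: t_def tp_def)
    then have "A (Suc j) * t (Suc j) \<le> A (Suc j) * tp (Suc j)"
      using A by (intro mult_left_mono) auto
    moreover have "(?v + c) * (?G (?v + e) - ?G ?v) \<le> e * ?G ?v"
      using F_chord x e by blast
    moreover have "e * ?G ?v \<le> e * 4" 
      using F_ub[of ?v "Suc j"] x[of "Suc j"] e by (intro mult_left_mono) auto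
    moreover have "e * (?G (?v + e) - F j (x j)) \<le> e * 4"
      using F_ub[of "?v + e" "Suc j"] x e F_nonneg[of "x j" j] by (intro mult_left_mono) auto
    moreover have "A j * tp (Suc j) - (?v + c) * t (Suc j) - g j
      = - d j + (?v + c) * (?G (?v + e) - ?G ?v) + e * (?G (?v + e) - F j (x j))"
      unfolding d_def g_def t_def tp_def FA by (simp add: algebra_simps)
    moreover have "(A j - A (Suc j)) * tp (Suc j) - (?v - x (Suc (Suc j))) * t (Suc j)
      = A j * tp (Suc j) - A (Suc j) * tp (Suc j) + A (Suc j) * t (Suc j) - (?v + c) * t (Suc j) - g (Suc j)"
      unfolding g_def by (simp add: algebra_simps)
    ultimately show ?thesis by linarith
  qed
  have "g 0 = 0" by (simp add: g_def t_def x0)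
  have "g b \<ge> 0"
  proof -
    have gb: "g b = lam * ((x b)\<^sup>2 - (st b)\<^sup>2) * (F b (x b) - F b (st b))"
      by (simp add: g_def A_def t_def xb c_def st_b F_st[of b, unfolded st_b] algebra_simps)
    show ?thesis
    proof (cases "st b \<le> x b")
      case True
      then show ?thesis unfolding gb using lam_pos st_nonneg F_mono
        by (intro mult_nonneg_nonneg) (auto intro: power_mono)
    next
      case False
      then show ?thesis unfolding gb using lam_pos x F_mono[of "x b" "st b" b]
        by (intro mult_nonpos_nonpos mult_nonneg_nonpos) (auto intro: power_mono)
    qed
  qed
  have "jsq_gen N b lam (grid_pot N b (\<lambda>k v. F k v - 1)) s
     = (\<Sum>j<b. (A j - A (Suc j)) * tp (Suc j) - (x (Suc j) - x (Suc (Suc j))) * t (Suc j))"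
    unfolding jsq_gen_grid_pot[OF s N] One_nat_def sum.atLeast1_atMost_eq
    by (intro sum.cong refl) (simp add: A_def tp_def t_def x_def e_def right_diff_distrib)
  also have "\<dots> \<le> (\<Sum>j<b. 8 * e - d j - (g (Suc j) - g j))"
    using bracket by (intro sum_mono) auto
  also have "\<dots> = 8 * real b * e - (\<Sum>j<b. d j) - (g b - g 0)"
    unfolding sum_subtractf[of "\<lambda>j. 8 * e - d j"] sum_lessThan_telescope by (simp add: sum_subtractf)
  also have "\<dots> \<le> 8 * real b * e - (\<Sum>j<b. d j)"
    using \<open>g 0 = 0\<close> \<open>g b \<ge> 0\<close> by simp
  also have "(\<Sum>j<b. d j) = diss N s"
    by (simp add: diss_def d_def A_def x_def e_def)
  finally show ?thesis by (simp add: e_def)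
qed

text \<open>From level to level the deviation at most doubles and gains \<open>y j\<close>. After
  unrolling, Cauchy-Schwarz is applied with weights \<open>r j\<close>, whose sum is at most 1 and
  which cancel the slope loss \<open>2 ^ j\<close>.\<close>

lemma sq_dev_le_diss:
  assumes s: "s \<in> jsq_states N b" and N: "N \<ge> 1" and lamN: "lam * (1 + 1 / real N) \<le> 1"
    and k: "k \<le> b"
  shows "(sext b s k - st k)\<^sup>2 \<le> 4 ^ k * (6 * diss N s + 2 / real N)"
proof -
  define e where "e = 1 / real N"
  define x where "x k = sext b s k" for k
  define u where "u j = lam * (x j)\<^sup>2 - c" for j
  define w where "w j = x (Suc j) + e" for j
  define d where "d j = (u j - w j) * (F (Suc j) (u j) - F (Suc j) (w j))" for j
  define y where "y j = \<bar>u j - w j\<bar> + e" for j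
  define r :: "nat \<Rightarrow> real" where "r j = (1/2) ^ Suc j" for j
  have e: "e \<ge> 0" "lam * (1 + e) \<le> 1" "e \<le> 1" using N lamN by (auto simp: e_def)
  have x: "0 \<le> x k" "x k \<le> 1" for k using sext_bounds[OF s N] by (auto simp: x_def)
  have x0: "x 0 = 1" by (auto simp: x_def sext_def)
  have diss: "diss N s = (\<Sum>j<b. d j)"
    by (simp add: diss_def d_def u_def w_def x_def e_def)
  have le1: "1 + e \<le> (1 + c) / lam"
    using e lam_pos c_nonneg by (simp add: pos_le_divide_eq mult.commute)
  have dom: "- c \<le> u j" "u j \<le> (1 + c) / lam" "- c \<le> w j" "w j \<le> (1 + c) / lam" for j
  proof -
    have "lam * (x j)\<^sup>2 \<le> 1 * 1" using lam x[of j] by (intro mult_mono power_le_one) auto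
    then show "u j \<le> (1 + c) / lam" using c_nonneg le1 e by (simp add: u_def)
    show "- c \<le> u j" using lam_pos by (simp add: u_def)
    show "- c \<le> w j" "w j \<le> (1 + c) / lam"
      using x[of "Suc j"] c_nonneg e le1 by (auto simp: w_def)
  qed
  have ds: "(u j - w j)\<^sup>2 \<le> 6 * 2 ^ j * d j" if "j < b" for j
    unfolding d_def by (intro F_Suc_slope_sq dom that)
  have d0: "0 \<le> d j" if "j < b" for j
  proof -
    have "0 \<le> 6 * 2 ^ j * d j" using ds[OF that] zero_le_power2 order_trans by blast
    then show ?thesis using mult_le_cancel_left_pos[of "6 * 2 ^ j" 0 "d j"] by simp
  qed
  have step: "\<bar>x (Suc j) - st (Suc j)\<bar> \<le> 2 * \<bar>x j - st j\<bar> + y j" if "j < b" for j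
  proof -
    have "x (Suc j) - st (Suc j) = lam * (x j + st j) * (x j - st j) - (u j - w j) - e"
      using that by (simp add: st_Suc u_def w_def power2_eq_square algebra_simps)
    then have "\<bar>x (Suc j) - st (Suc j)\<bar> \<le> \<bar>lam * (x j + st j) * (x j - st j)\<bar> + y j"
      using e by (simp add: y_def)
    also have "\<bar>lam * (x j + st j) * (x j - st j)\<bar> = lam * (x j + st j) * \<bar>x j - st j\<bar>"
      using lam_pos x[of j] st_nonneg[of j] by (simp add: abs_mult)
    also have "\<dots> \<le> (1 * 2) * \<bar>x j - st j\<bar>"
      using lam x[of j] st_nonneg[of j] st_le_1[of j] by (intro mult_right_mono mult_mono) auto
    finally show ?thesis by simp
  qed
  have lin: "\<bar>x k - st k\<bar> \<le> 2 ^ k * (\<Sum>j<k. r j * y j)" if "k \<le> b" for k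
    using that
  proof (induction k)
    case (Suc k)
    have "2 ^ Suc k * (r k * y k) = y k" by (simp add: r_def power_divide)
    then have "2 ^ Suc k * (\<Sum>j<Suc k. r j * y j) = 2 * (2 ^ k * (\<Sum>j<k. r j * y j)) + y k"
      by (simp add: distrib_left)
    then show ?case using step[of k] Suc by simp
  qed (simp add: x0)
  have r: "r j \<ge> 0" for j by (simp add: r_def)
  have sum_r: "(\<Sum>j<k. r j) \<le> 1"
  proof -
    have "(\<Sum>j<k. r j) = 1 - (1/2) ^ k" by (induction k) (simp_all add: r_def)
    then show ?thesis by simp
  qed
  \<comment> \<open>Splitting \<open>r j\<close> into two square roots leaves the weight in both
    Cauchy-Schwarz factors.\<close>
  have "(\<Sum>j<k. r j * y j)\<^sup>2 = (\<Sum>j<k. sqrt (r j) * (sqrt (r j) * y j))\<^sup>2"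
    using r by (simp add: mult.assoc[symmetric])
  also have "\<dots> \<le> (\<Sum>j<k. (sqrt (r j))\<^sup>2) * (\<Sum>j<k. (sqrt (r j) * y j)\<^sup>2)"
    by (rule Cauchy_Schwarz_ineq_sum)
  also have "\<dots> = (\<Sum>j<k. r j) * (\<Sum>j<k. r j * (y j)\<^sup>2)"
    using r by (simp add: power_mult_distrib)
  also have "\<dots> \<le> 1 * (\<Sum>j<k. r j * (y j)\<^sup>2)"
    using sum_r r by (intro mult_right_mono sum_nonneg) auto
  also have "\<dots> \<le> (\<Sum>j<k. 6 * d j + r j * (2 * e))"
    unfolding mult_1
  proof (intro sum_mono)
    fix j assume "j \<in> {..<k}"
    then have j: "j < b" using k by simp
    have "(y j)\<^sup>2 \<le> 2 * (u j - w j)\<^sup>2 + 2 * e\<^sup>2"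
      using sum_squares_bound[of "\<bar>u j - w j\<bar>" e] by (simp add: y_def power2_sum)
    also have "\<dots> \<le> 2 * (6 * 2 ^ j * d j) + 2 * e"
      using ds[OF j] e by (intro add_mono mult_left_mono) (auto simp: power2_eq_square mult_left_le)
    finally have "r j * (y j)\<^sup>2 \<le> r j * (2 * (6 * 2 ^ j * d j) + 2 * e)"
      using r by (intro mult_left_mono)
    also have "\<dots> = 6 * d j + r j * (2 * e)"
      by (simp add: r_def distrib_left power_divide)
    finally show "r j * (y j)\<^sup>2 \<le> 6 * d j + r j * (2 * e)" .
  qed
  also have "\<dots> = 6 * (\<Sum>j<k. d j) + (\<Sum>j<k. r j) * (2 * e)"
    by (simp add: sum.distrib sum_distrib_left sum_distrib_right)
  also have "\<dots> \<le> 6 * (\<Sum>j<b. d j) + 1 * (2 * e)"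
    using d0 k sum_r e by (intro add_mono mult_left_mono mult_right_mono sum_mono2) auto
  finally have S: "(\<Sum>j<k. r j * y j)\<^sup>2 \<le> 6 * diss N s + 2 * e" by (simp add: diss)
  have "(x k - st k)\<^sup>2 = \<bar>x k - st k\<bar>\<^sup>2" by simp
  also have "\<dots> \<le> (2 ^ k * (\<Sum>j<k. r j * y j))\<^sup>2"
    using lin[OF k] by (intro power_mono) auto
  also have "\<dots> = 4 ^ k * (\<Sum>j<k. r j * y j)\<^sup>2"
    by (simp add: power2_eq_square power_mult_distrib[symmetric])
  also have "\<dots> \<le> 4 ^ k * (6 * diss N s + 2 * e)"
    using S by (intro mult_left_mono) auto
  finally show ?thesis by (simp add: x_def e_def)
qed

text \<open>Beyond level \<open>K\<close> the factor \<open>4 ^ k\<close> is avoided: both \<open>s\<close> and the fixed point are monotone,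
  and the latter is negligible at level \<open>K\<close>.\<close>

lemma sqdist_le_diss:
  assumes s: "s \<in> jsq_states N b" and N: "N \<ge> 1" and lamN: "lam * (1 + 1 / real N) \<le> 1"
  shows "sqdist b s sstar \<le> real b * (2 * 4 ^ K * (6 * diss N s + 2 / real N) + 2 * (lam ^ (2 ^ K - 1))\<^sup>2)"
proof -
  let ?x = "sext b s" and ?D = "6 * diss N s + 2 / real N" and ?l = "lam ^ (2 ^ K - 1)"
  \<comment> \<open>At level 0 the factor \<open>4 ^ k\<close> is 1, so \<open>?D\<close> bounds a
    square.\<close>
  have D: "?D \<ge> 0" using order_trans[OF zero_le_power2 sq_dev_le_diss[OF s N lamN, of 0]] by simp
  have "(s k - sstar k)\<^sup>2 \<le> 2 * 4 ^ K * ?D + 2 * ?l\<^sup>2" if k: "k \<in> {1..b}" for k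
  proof -
    have eq: "s k - sstar k = ?x k - st k" using k by (simp add: sext_def)
    show ?thesis
    proof (cases "k \<le> K")
      case True
      have "(?x k - st k)\<^sup>2 \<le> 4 ^ k * ?D" using sq_dev_le_diss[OF s N lamN] k by simp
      also have "\<dots> \<le> (2 * 4 ^ K) * ?D"
      proof (intro mult_right_mono D)
        have "(4::real) ^ k \<le> 4 ^ K" using True by (intro power_increasing) auto
        also have "\<dots> \<le> 2 * 4 ^ K" by simp
        finally show "(4::real) ^ k \<le> 2 * 4 ^ K" .
      qed
      finally show ?thesis unfolding eq by (smt (verit) zero_le_power2)
    next
      case False
      then have K: "K \<le> k" "K \<le> b" using k by auto
      \<comment> \<open>Both values at \<open>k\<close> lie between 0 and the corresponding value at
        \<open>K\<close>, so their distance is at most the larger of the values at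
        \<open>K\<close>.\<close>
      have "\<bar>?x k - st k\<bar> \<le> \<bar>?x K - st K\<bar> + st K"
        using sext_antimono[OF s N K(1)] st_antimono[OF K(1)] k sext_bounds[OF s N, of k] st_nonneg[of k]
        by auto
      also have "\<dots> \<le> \<bar>?x K - st K\<bar> + ?l" using st_le_power[OF K(2)] by simp
      finally have "\<bar>?x k - st k\<bar>\<^sup>2 \<le> (\<bar>?x K - st K\<bar> + ?l)\<^sup>2" by (intro power_mono) auto
      also have "\<dots> \<le> 2 * (?x K - st K)\<^sup>2 + 2 * ?l\<^sup>2"
        using sum_squares_bound[of "\<bar>?x K - st K\<bar>" ?l] by (simp add: power2_sum)
      also have "\<dots> \<le> 2 * (4 ^ K * ?D) + 2 * ?l\<^sup>2"
        using sq_dev_le_diss[OF s N lamN K(2)] by simp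
      finally show ?thesis unfolding eq by (simp only: power2_abs mult.assoc)
    qed
  qed
  then have "sqdist b s sstar \<le> (\<Sum>k\<in>{1..b}. 2 * 4 ^ K * ?D + 2 * ?l\<^sup>2)"
    unfolding sqdist_def by (intro sum_mono)
  then show ?thesis by simp
qed

text \<open>The pointwise bound is affine in the generator, whose stationary mean is 0. The constant
  is \<open>100 = 2 * 50\<close>, from \<open>48 * b + 2 <= 50 * b\<close>.\<close>

lemma expectation_sqdist_le:
  assumes p: "jsq_stationary N b lam p" and N: "N \<ge> 1" and lamN: "lam * (1 + 1 / real N) \<le> 1"
  shows "measure_pmf.expectation p (\<lambda>s. sqdist b s sstar)
    \<le> real b * (100 * 4 ^ K * real b / real N + 2 * (lam ^ (2 ^ K - 1))\<^sup>2)"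
proof -
  let ?g = "jsq_gen N b lam (grid_pot N b (\<lambda>k v. F k v - 1))"
  let ?l = "lam ^ (2 ^ K - 1)"
  define C0 where "C0 = real b * (2 * 4 ^ K * (48 * real b / real N + 2 / real N) + 2 * ?l\<^sup>2)"
  define C1 where "C1 = real b * (2 * 4 ^ K * 6)"
  have sub: "set_pmf p \<subseteq> jsq_states N b" using p by (simp add: jsq_stationary_def)
  have int: "integrable (measure_pmf p) f" for f :: "_ \<Rightarrow> real"
    using finite_subset[OF sub finite_jsq_states] by (rule integrable_measure_pmf_finite)
  have le: "sqdist b s sstar \<le> C0 - C1 * ?g s" if "s \<in> set_pmf p" for s
  proof -
    have s: "s \<in> jsq_states N b" using that sub by blast
    have "6 * diss N s + 2 / real N \<le> 48 * real b / real N + 2 / real N - 6 * ?g s"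
      using jsq_gen_le_diss[OF s N lamN] by simp
    then have "sqdist b s sstar \<le> real b * (2 * 4 ^ K * (48 * real b / real N + 2 / real N - 6 * ?g s) + 2 * ?l\<^sup>2)"
      by (intro order_trans[OF sqdist_le_diss[OF s N lamN, of K]] mult_left_mono add_right_mono) auto
    also have "\<dots> = C0 - C1 * ?g s" unfolding C0_def C1_def by (simp add: algebra_simps)
    finally show ?thesis .
  qed
  have "measure_pmf.expectation p (\<lambda>s. sqdist b s sstar) \<le> measure_pmf.expectation p (\<lambda>s. C0 - C1 * ?g s)"
    using le by (intro integral_mono_AE int) (simp add: AE_measure_pmf_iff)
  also have "\<dots> = C0 - C1 * measure_pmf.expectation p ?g"
    by (subst Bochner_Integration.integral_diff[OF int int]) simp
  also have "\<dots> = C0" by (simp add: expectation_jsq_gen[OF p])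
  also have "\<dots> \<le> real b * (2 * 4 ^ K * (50 * real b / real N) + 2 * ?l\<^sup>2)"
    unfolding C0_def using b N
    by (intro mult_left_mono add_right_mono) (simp_all add: add_divide_distrib[symmetric] divide_right_mono)
  finally show ?thesis by (simp add: mult.assoc)
qed

end

section \<open>Asymptotics\<close>

text \<open>With \<open>C * ln x\<close> bounding the buffer size, the first estimate absorbs the
  squared logarithm of the dissipation part (\<open>400 = 100 * 4\<close>), the second the remainder
  beyond level \<open>K\<close>; each takes half of the final bound.\<close>

lemma log_pow_dominated:
  fixes \<gamma> \<xi> C :: real
  assumes "0 < \<gamma>" "0 < \<xi>" "0 < C"
  shows "\<forall>\<^sub>F x in at_top. 400 * C\<^sup>2 * (ln x)\<^sup>2 \<le> x powr (2 * \<xi>) / 2"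
    and "\<forall>\<^sub>F x in at_top. 2 * C * ln x * exp (1 - \<gamma> * x powr \<xi>) \<le> 1 / x / 2"
  using assms by real_asymp+

theorem theorem2:
  fixes \<gamma> \<alpha> \<xi> :: real and b :: "nat \<Rightarrow> nat"
  assumes "0 < \<gamma>" "\<gamma> \<le> 1" "0 < \<alpha>" "\<alpha> < 1/4" "0 < \<xi>"
    and "\<And>N. b N \<ge> 1"
    and "(\<lambda>N. real (b N)) \<in> O(\<lambda>N. ln (real N))"
  shows "\<forall>\<^sub>F N in sequentially.
     \<forall>p sstar. jsq_stationary N (b N) (1 - \<gamma> / real N powr \<alpha>) p \<longrightarrow>
       is_fixed_point (b N) (1 - \<gamma> / real N powr \<alpha>) sstar \<longrightarrow>
       measure_pmf.expectation p (\<lambda>s. sqdist (b N) s sstar)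
         \<le> (if \<alpha> < 1/12 then 1 / real N powr (1 - 2*\<alpha> - 4*\<xi>)
            else 1 / real N powr (1 - 4*\<alpha> - 7*\<xi>))"
proof -
  obtain C where C: "C > 0" and bC: "\<forall>\<^sub>F N in sequentially. norm (real (b N)) \<le> C * norm (ln (real N))"
    using landau_o.bigE[OF assms(7)] by blast
  \<comment> \<open>\<open>half\<close> yields \<open>lam >= 1/2\<close>, and \<open>large\<close>
    yields \<open>lam * (1 + 1 / N) <= 1\<close>.\<close>
  have half: "\<forall>\<^sub>F x in at_top. \<gamma> / x powr \<alpha> \<le> 1/2"
    and large: "\<forall>\<^sub>F x in at_top. 1 / x \<le> \<gamma> / x powr \<alpha>"
    using assms(1-4) by real_asymp+
  note nat_seq = eventually_compose_filterlim[OF _ filterlim_real_sequentially]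
  note logs = log_pow_dominated[OF assms(1,5) C]
  show ?thesis
    using bC eventually_ge_at_top[of 2] nat_seq[OF half] nat_seq[OF large]
      nat_seq[OF logs(1)] nat_seq[OF logs(2)]
  proof eventually_elim
    case (elim N)
    define x where "x = real N"
    define \<delta> where "\<delta> = \<gamma> / x powr \<alpha>"
    define lam where "lam = 1 - \<delta>"
    \<comment> \<open>The least level with \<open>2 ^ K >= x powr (\<xi> + \<alpha>)\<close>;
      rounding up costs at most a factor 2.\<close>
    define K where "K = nat \<lceil>log 2 (x powr (\<xi> + \<alpha>))\<rceil>"
    have x: "x \<ge> 2" using elim by (simp add: x_def)
    have \<delta>: "0 \<le> \<delta>" "\<delta> \<le> 1/2" "1 / x \<le> \<delta>" using elim assms(1) by (auto simp: \<delta>_def x_def)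
    have N: "N \<ge> 1" using elim by simp
    have b: "real (b N) \<le> C * ln x" using elim x by (simp add: x_def)
    have lamN: "lam * (1 + 1 / real N) \<le> 1"
    proof -
      have "0 \<le> \<delta> * (1 / x)" using \<delta> x by simp
      moreover have "lam * (1 + 1 / x) = 1 - \<delta> + 1 / x - \<delta> * (1 / x)" by (simp add: lam_def diff_divide_distrib algebra_simps)
      ultimately have "lam * (1 + 1 / x) \<le> 1" using \<delta> by linarith
      then show ?thesis by (simp add: x_def)
    qed
    have y: "x powr (\<xi> + \<alpha>) \<ge> 1" using x assms by (intro ge_one_powr_ge_zero) auto
    have log: "0 \<le> log 2 (x powr (\<xi> + \<alpha>))" using y by (subst zero_le_log_cancel_iff) auto
    have rK: "(2::real) ^ K = 2 powr real K" by (simp add: powr_realpow)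
    have K1: "x powr (\<xi> + \<alpha>) \<le> 2 ^ K"
    proof -
      have "log 2 (x powr (\<xi> + \<alpha>)) \<le> real K" unfolding K_def by linarith
      then show ?thesis unfolding rK using y by (subst (asm) log_le_iff) auto
    qed
    have K2: "2 ^ K \<le> 2 * x powr (\<xi> + \<alpha>)"
    proof -
      have "real K \<le> 1 + log 2 (x powr (\<xi> + \<alpha>))" unfolding K_def using log by linarith
      then have "2 powr real K \<le> 2 powr (1 + log 2 (x powr (\<xi> + \<alpha>)))" by simp
      then show ?thesis unfolding rK using y by (simp add: powr_add)
    qed
    have K4: "4 ^ K \<le> 4 * x powr (2 * \<xi> + 2 * \<alpha>)"
    proof -
      have "(4::real) ^ K = (2 ^ K)\<^sup>2" by (simp add: power2_eq_square power_mult_distrib[symmetric])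
      also have "\<dots> \<le> (2 * x powr (\<xi> + \<alpha>))\<^sup>2" using K2 by (intro power_mono) auto
      also have "\<dots> = 4 * x powr (2 * \<xi> + 2 * \<alpha>)"
        by (simp add: power2_eq_square powr_add[symmetric])
      finally show ?thesis .
    qed
    have l0: "0 \<le> lam" "lam \<le> 1" using \<delta> by (auto simp: lam_def)
    \<comment> \<open>This rests on \<open>lam <= exp (- \<delta>)\<close> and
      \<open>\<delta> * x powr \<alpha> = \<gamma>\<close>. The 1 in the exponent pays for the
      off-by-one in \<open>2 ^ K - 1\<close>, as \<delta> is at most 1.\<close>
    have l: "(lam ^ (2 ^ K - 1))\<^sup>2 \<le> exp (1 - \<gamma> * x powr \<xi>)"
    proof -
      have "(lam ^ (2 ^ K - 1))\<^sup>2 \<le> lam ^ (2 ^ K - 1)"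
        using l0 by (simp add: power2_eq_square mult_left_le power_le_one)
      also have "\<dots> \<le> exp (- \<delta>) ^ (2 ^ K - 1)"
        using l0 exp_ge_add_one_self[of "- \<delta>"] by (intro power_mono) (auto simp: lam_def)
      also have "\<dots> = exp (real (2 ^ K - 1) * - \<delta>)" by (rule exp_of_nat_mult[symmetric])
      also have "\<dots> = exp (\<delta> - \<delta> * 2 ^ K)" by (simp add: of_nat_diff algebra_simps)
      also have "\<dots> \<le> exp (1 - \<delta> * x powr (\<xi> + \<alpha>))"
        using \<delta> mult_left_mono[OF K1 \<delta>(1)] by simp
      also have "\<delta> * x powr (\<xi> + \<alpha>) = \<gamma> * x powr \<xi>" using x by (simp add: \<delta>_def powr_add)
      finally show ?thesis .
    qed
    have lnx: "0 \<le> ln x" using x by simp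
    have "real (b N) * (100 * 4 ^ K * real (b N) / x + 2 * (lam ^ (2 ^ K - 1))\<^sup>2)
      \<le> (C * ln x) * (100 * (4 * x powr (2 * \<xi> + 2 * \<alpha>)) * (C * ln x) / x + 2 * exp (1 - \<gamma> * x powr \<xi>))"
      using b K4 l x C lnx by (intro mult_mono add_mono divide_right_mono) auto
    also have "\<dots> = (400 * C\<^sup>2 * (ln x)\<^sup>2) * (x powr (2 * \<xi> + 2 * \<alpha>) / x) + 2 * C * ln x * exp (1 - \<gamma> * x powr \<xi>)"
      by (simp add: power2_eq_square algebra_simps)
    also have "\<dots> \<le> x powr (2 * \<xi>) / 2 * (x powr (2 * \<xi> + 2 * \<alpha>) / x) + 1 / x / 2"
      using elim x by (intro add_mono mult_right_mono) (auto simp: x_def)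
    also have "x powr (2 * \<xi>) / 2 * (x powr (2 * \<xi> + 2 * \<alpha>) / x) = x powr (2 * \<alpha> + 4 * \<xi> - 1) / 2"
      using x by (simp add: powr_diff powr_add[symmetric] ac_simps)
    also have "1 / x = x powr (- 1)" using x by (simp add: powr_minus_divide)
    also have "\<dots> \<le> x powr (2 * \<alpha> + 4 * \<xi> - 1)" using x assms by (intro powr_mono) auto
    finally have bound: "real (b N) * (100 * 4 ^ K * real (b N) / x + 2 * (lam ^ (2 ^ K - 1))\<^sup>2)
      \<le> x powr (2 * \<alpha> + 4 * \<xi> - 1)" by simp
    \<comment> \<open>The bound stated for small \<alpha> is the smaller of the two, so one estimate
      serves both cases.\<close>
    have "x powr (2 * \<alpha> + 4 * \<xi> - 1) \<le> x powr (4 * \<alpha> + 7 * \<xi> - 1)"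
      using x assms by (intro powr_mono) auto
    then have rhs: "x powr (2 * \<alpha> + 4 * \<xi> - 1)
      \<le> (if \<alpha> < 1/12 then 1 / x powr (1 - 2*\<alpha> - 4*\<xi>) else 1 / x powr (1 - 4*\<alpha> - 7*\<xi>))"
      by (simp add: powr_minus_divide[symmetric] algebra_simps)
    show ?case
    proof (intro allI impI)
      fix p sstar
      assume p: "jsq_stationary N (b N) (1 - \<gamma> / real N powr \<alpha>) p"
        and fp: "is_fixed_point (b N) (1 - \<gamma> / real N powr \<alpha>) sstar"
      have lam_eq: "1 - \<gamma> / real N powr \<alpha> = lam" by (simp add: lam_def \<delta>_def x_def)
      interpret jsq_fixed_point "b N" lam sstar
        using assms(6) \<delta> fp unfolding lam_eq by unfold_locales (auto simp: lam_def)
      show "measure_pmf.expectation p (\<lambda>s. sqdist (b N) s sstar)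
         \<le> (if \<alpha> < 1/12 then 1 / real N powr (1 - 2*\<alpha> - 4*\<xi>)
            else 1 / real N powr (1 - 4*\<alpha> - 7*\<xi>))"
        using expectation_sqdist_le[OF p[unfolded lam_eq] N lamN, of K] bound rhs
        unfolding x_def by linarith
    qed
  qed
qed

end
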